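(* Let $H$ be a space of real functions on $\mathbb R$ closed under shifts, equipped with the cylindrical $\sigma$-field, and let $T>0$. (A) Let $L_T:H\times\mathbb R\to\mathbb R\cup\{\infty\}$ be a local intrinsic location functional with related length $T$, let $f\in H$, and put $g(x)=L_T(f,x)-x$ for $x\in\mathbb R$. Then there exists a roughest partition of the real line by intervals (possibly degenerate, possibly unbounded, with open or closed boundaries) such that for any member $I$ of the partition, with left endpoint $a$ and right endpoint $b$ (so $I=(a,b)$, $(a,b]$, $[a,b)$ or $[a,b]$), exactly one of the following is true: (1) $b-a\le T$, and there is $d\in[b,a+T]$ such that $g(x)=d-x$ for all $x\in I$; (2) $g(x)=\infty$ for all $x\in I$. Moreover, for any member $I$ of this partition with left endpoint $a$ and right endpoint $b$: if $g(a)\ne T$ then $\lim_{x\uparrow a}g(x)=0$; if $g(b)\neq0$ then $\lim_{x\downarrow b}g(x)=T$; if $I$ is open at $a$ then $g(a)=0$; if $I$ is open at $b$ then $g(b)=T$ (the conditions at $a$, resp. $b$, being imposed when $a$, resp. $b$, is finite). (B) Conversely, let $L_T:H\times\mathbb R\to\mathbb R\cup\{\infty\}$ be a map such that $L_T(\cdot,a)$ is measurable for every $a\in\mathbb R$, and $L_T(f,a)=L_T(\theta_cf,a-c)+c$ for all $f\in H$, $a,c\in\mathbb R$. If for every $f\in H$, with $g(x)=L_T(f,x)-x$, there exists a partition of the real line by intervals satisfying all the properties listed in (A), then $L_T$ is a local intrinsic location functional with related length $T$.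
   Context: For $f\in H$, $c\in\mathbb R$: $\theta_cf(x)=f(x+c)$; closed under shifts means $\theta_cf\in H$. $\mathbb R\cup\{\infty\}$ carries the $\sigma$-field generated by the Borel sets of $\mathbb R$ and $\{\infty\}$; $\infty+c=\infty$ for $c\in\mathbb R$, so $g(x)=\infty$ when $L_T(f,x)=\infty$. Local intrinsic location functional with related length $T>0$: a map $L_T:H\times\mathbb R\to\mathbb R\cup\{\infty\}$ such that (1) for every $a\in\mathbb R$, $L_T(\cdot,a):H\to\mathbb R\cup\{\infty\}$ is measurable; (2) $L_T(f,a)\in[a,a+T]\cup\{\infty\}$ for all $f\in H$, $a\in\mathbb R$; (3) $L_T(f,a)=L_T(\theta_cf,a-c)+c$ for all $f\in H$, $a,c\in\mathbb R$; (4) for all $f\in H$, $a,b\in\mathbb R$, $L_T(f,a)\in[b,b+T]$ implies that either $L_T(f,b)=L_T(f,a)$ or $L_T(f,b)\in[b,b+T]\setminus[a,a+T]$. A partition satisfying a certain property (here: each member $I$, with left endpoint $a$ and right endpoint $b$, satisfies exactly one of: $b-a\le T$ and $g(x)=d-x$ on $I$ for some $d\in[b,a+T]$; or $g(x)=\infty$ on $I$) is called the roughest if every other partition satisfying the same property is a refinement of it. *)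

theory Defs
  imports "HOL-Analysis.Analysis" "HOL-Library.Disjoint_Sets"
begin

definition shift :: "real \<Rightarrow> (real \<Rightarrow> real) \<Rightarrow> real \<Rightarrow> real" where
  "shift c f = (\<lambda>x. f (x + c))"

definition closed_under_shifts :: "(real \<Rightarrow> real) set \<Rightarrow> bool" where
  "closed_under_shifts H \<longleftrightarrow> (\<forall>f\<in>H. \<forall>c. shift c f \<in> H)"

definition cylindrical :: "(real \<Rightarrow> real) set \<Rightarrow> (real \<Rightarrow> real) measure" where
  "cylindrical H = restrict_space (\<Pi>\<^sub>M t\<in>UNIV. borel) H"

(* The set of real numbers extended by infinity is represented by the extended reals other than
   minus infinity; its sigma-algebra is generated by the real Borel sets and {infinity}.  Because
   measurable functions map into the space of their target, measurability into real_infinity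
   also excludes the value minus infinity. *)
definition real_infinity :: "ereal measure" where
  "real_infinity = sigma {-\<infinity><..} ((`) ereal ` sets borel \<union> {{\<infinity>}})"

(* A map on H times the reals is represented by a total function of which only the values at
   f in H are constrained. *)
definition sections_measurable ::
    "(real \<Rightarrow> real) set \<Rightarrow> ((real \<Rightarrow> real) \<Rightarrow> real \<Rightarrow> ereal) \<Rightarrow> bool" where
  "sections_measurable H L \<longleftrightarrow>
     (\<forall>a. (\<lambda>f. L f a) \<in> cylindrical H \<rightarrow>\<^sub>M real_infinity)"

definition shift_compatible ::
    "(real \<Rightarrow> real) set \<Rightarrow> ((real \<Rightarrow> real) \<Rightarrow> real \<Rightarrow> ereal) \<Rightarrow> bool" where
  "shift_compatible H L \<longleftrightarrow>
     (\<forall>f\<in>H. \<forall>a c. L f a = L (shift c f) (a - c) + ereal c)"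

definition local_intrinsic_location ::
    "(real \<Rightarrow> real) set \<Rightarrow> real \<Rightarrow> ((real \<Rightarrow> real) \<Rightarrow> real \<Rightarrow> ereal) \<Rightarrow> bool" where
  "local_intrinsic_location H T L \<longleftrightarrow>
     sections_measurable H L \<and>
     (\<forall>f\<in>H. \<forall>a. L f a \<in> {ereal a..ereal (a + T)} \<union> {\<infinity>}) \<and>
     shift_compatible H L \<and>
     (\<forall>f\<in>H. \<forall>a b. L f a \<in> {ereal b..ereal (b + T)} \<longrightarrow>
        L f b = L f a \<or>
        L f b \<in> {ereal b..ereal (b + T)} - {ereal a..ereal (a + T)})"

definition displacement :: "((real \<Rightarrow> real) \<Rightarrow> real \<Rightarrow> ereal) \<Rightarrow> (real \<Rightarrow> real) \<Rightarrow> real \<Rightarrow> ereal" where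
  "displacement L f x = L f x - ereal x"

definition left_end :: "real set \<Rightarrow> ereal" where
  "left_end I = (INF x\<in>I. ereal x)"

definition right_end :: "real set \<Rightarrow> ereal" where
  "right_end I = (SUP x\<in>I. ereal x)"

(* For nonempty I the length bound forces both endpoints to be finite. *)
definition linear_piece :: "real \<Rightarrow> (real \<Rightarrow> ereal) \<Rightarrow> real set \<Rightarrow> bool" where
  "linear_piece T g I \<longleftrightarrow>
     right_end I - left_end I \<le> ereal T \<and>
     (\<exists>d::real. right_end I \<le> ereal d \<and> ereal d \<le> left_end I + ereal T \<and>
        (\<forall>x\<in>I. g x = ereal (d - x)))"

definition infinite_piece :: "(real \<Rightarrow> ereal) \<Rightarrow> real set \<Rightarrow> bool" where
  "infinite_piece g I \<longleftrightarrow> (\<forall>x\<in>I. g x = \<infinity>)"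

definition piecewise_linear_partition :: "real \<Rightarrow> (real \<Rightarrow> ereal) \<Rightarrow> real set set \<Rightarrow> bool" where
  "piecewise_linear_partition T g P \<longleftrightarrow>
     partition_on UNIV P \<and>
     (\<forall>I\<in>P. is_interval I \<and>
        (linear_piece T g I \<and> \<not> infinite_piece g I \<or>
         \<not> linear_piece T g I \<and> infinite_piece g I))"

definition roughest :: "(real set set \<Rightarrow> bool) \<Rightarrow> real set set \<Rightarrow> bool" where
  "roughest \<Phi> P \<longleftrightarrow> partition_on UNIV P \<and> \<Phi> P \<and>
     (\<forall>Q. partition_on UNIV Q \<and> \<Phi> Q \<longrightarrow> refines UNIV Q P)"

definition boundary_conditions :: "real \<Rightarrow> (real \<Rightarrow> ereal) \<Rightarrow> real set set \<Rightarrow> bool" where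
  "boundary_conditions T g P \<longleftrightarrow>
     (\<forall>I\<in>P.
        (\<forall>a::real. left_end I = ereal a \<longrightarrow>
           (g a \<noteq> ereal T \<longrightarrow> (g \<longlongrightarrow> 0) (at_left a)) \<and>
           (a \<notin> I \<longrightarrow> g a = 0)) \<and>
        (\<forall>b::real. right_end I = ereal b \<longrightarrow>
           (g b \<noteq> 0 \<longrightarrow> (g \<longlongrightarrow> ereal T) (at_right b)) \<and>
           (b \<notin> I \<longrightarrow> g b = ereal T)))"

end

theory Submission
  imports Defs
begin

text \<open>
  Fix \<open>f\<close>, let \<open>F\<close> be the set of points \<open>x\<close> at which \<open>L f x\<close> is finite, and let \<open>l x\<close> be that finite
  value (\<open>l\<close> is arbitrary off \<open>F\<close>). The roughest partition consists of the level sets of \<open>l\<close> on \<open>F\<close>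
  and of the connected components of the complement of \<open>F\<close>.
  The map \<open>x \<mapsto> - x\<close> together with \<open>l \<mapsto> T - l\<close> preserves every hypothesis and exchanges left and right
  endpoints, so only left endpoints (in (A)) and points to the left (in (B)) need an argument.
  For the converse, given a finite value at \<open>a\<close> and \<open>b < a\<close> violating the local condition, consider
  the supremum of the violating points in \<open>[b, a]\<close>: it is an endpoint of a cell, where the
  boundary limits force incompatible values of \<open>l\<close> on the two sides.
\<close>

section \<open>Finite values, the local condition, and time reversal\<close>

text \<open>Conditions (2) and (4) for a functional with the real value \<open>l x\<close> on
  \<open>F\<close> and infinity elsewhere. The second clause omits that \<open>l b\<close> lies in
  the window \<open>[b, b + T]\<close>, because the first clause supplies it once
  \<open>b \<in> F\<close>.\<close>

definition local_on :: "real \<Rightarrow> real set \<Rightarrow> (real \<Rightarrow> real) \<Rightarrow> bool" where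
  "local_on T F l \<longleftrightarrow>
     (\<forall>x\<in>F. x \<le> l x \<and> l x \<le> x + T) \<and>
     (\<forall>a\<in>F. \<forall>b. b \<le> l a \<and> l a \<le> b + T \<longrightarrow> b \<in> F \<and> (l b = l a \<or> l b < a \<or> a + T < l b))"

lemma local_on_bounds:
  assumes "local_on T F l" "x \<in> F"
  shows "x \<le> l x" "l x \<le> x + T"
  using assms by (auto simp: local_on_def)

lemma local_onD:
  assumes "local_on T F l" "a \<in> F" "b \<le> l a" "l a \<le> b + T"
  shows "b \<in> F" "l b = l a \<or> l b < a \<or> a + T < l b"
  using assms by (auto simp: local_on_def)

text \<open>Negation alone places the value in \<open>[x - T, x]\<close>; adding \<open>T\<close>
  moves it back to the window \<open>[x, x + T]\<close> that starts at the reflected point.\<close>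

definition reflect :: "real \<Rightarrow> (real \<Rightarrow> real) \<Rightarrow> real \<Rightarrow> real" where
  "reflect T l x = T - l (- x)"

lemma uminus_image_iff: "x \<in> uminus ` A \<longleftrightarrow> - x \<in> A" for x :: real
  by force

lemma local_on_reflect:
  assumes "local_on T F l"
  shows "local_on T (uminus ` F) (reflect T l)"
  unfolding local_on_def reflect_def
proof (intro conjI allI ballI impI)
  fix x assume "x \<in> uminus ` F"
  then have x: "- x \<in> F" by (simp add: uminus_image_iff)
  show "x \<le> T - l (- x)" "T - l (- x) \<le> x + T"
    using local_on_bounds[OF assms x] by auto
next
  fix a b assume "a \<in> uminus ` F" and h: "b \<le> T - l (- a) \<and> T - l (- a) \<le> b + T"
  then have a: "- a \<in> F" by (simp add: uminus_image_iff)
  have b: "- b \<le> l (- a)" "l (- a) \<le> - b + T" using h by auto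
  show "b \<in> uminus ` F" using local_onD[OF assms a b] by (simp add: uminus_image_iff)
  show "T - l (- b) = T - l (- a) \<or> T - l (- b) < a \<or> a + T < T - l (- b)"
    using local_onD(2)[OF assms a b] by auto
qed

section \<open>Finite endpoints of sets of reals\<close>

text \<open>The epsilon form forces \<open>I\<close> to be nonempty and bounded below with infimum
  \<open>a\<close>, whereas \<open>Inf\<close> returns a value for every set. It thus captures
  finite endpoints only, and negation turns it into \<open>greatest_bound\<close>.\<close>

definition least_bound :: "real set \<Rightarrow> real \<Rightarrow> bool" where
  "least_bound I a \<longleftrightarrow> (\<forall>y\<in>I. a \<le> y) \<and> (\<forall>e>0. \<exists>y\<in>I. y < a + e)"

definition greatest_bound :: "real set \<Rightarrow> real \<Rightarrow> bool" where
  "greatest_bound I b \<longleftrightarrow> (\<forall>y\<in>I. y \<le> b) \<and> (\<forall>e>0. \<exists>y\<in>I. b - e < y)"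

lemma least_bound_uminus: "least_bound (uminus ` I) a \<longleftrightarrow> greatest_bound I (- a)"
proof -
  have "a \<le> - y \<longleftrightarrow> y \<le> - a" "- y < a + e \<longleftrightarrow> - a - e < y" for y e by auto
  then show ?thesis by (simp add: least_bound_def greatest_bound_def)
qed

lemma greatest_bound_uminus: "greatest_bound (uminus ` I) a \<longleftrightarrow> least_bound I (- a)"
proof -
  have "- y \<le> a \<longleftrightarrow> - a \<le> y" "a - e < - y \<longleftrightarrow> y < - a + e" for y e by auto
  then show ?thesis by (simp add: least_bound_def greatest_bound_def)
qed

lemma left_end_eq_ereal_iff:
  assumes "I \<noteq> {}"
  shows "left_end I = ereal a \<longleftrightarrow> least_bound I a"
proof
  assume h: "left_end I = ereal a"
  have "\<exists>y\<in>I. y < a + e" if "e > 0" for e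
  proof -
    have "(INF x\<in>I. ereal x) < ereal (a + e)"
      using h that unfolding left_end_def by simp
    then show ?thesis unfolding INF_less_iff by simp
  qed
  moreover have "a \<le> y" if "y \<in> I" for y
    using INF_lower[OF that, of ereal] h unfolding left_end_def by simp
  ultimately show "least_bound I a" by (auto simp: least_bound_def)
next
  assume h: "least_bound I a"
  show "left_end I = ereal a"
    unfolding left_end_def
  proof (rule antisym)
    show "ereal a \<le> (INF x\<in>I. ereal x)"
      using h by (intro INF_greatest) (simp add: least_bound_def)
    show "(INF x\<in>I. ereal x) \<le> ereal a"
    proof (rule ereal_le_epsilon2)
      fix e :: real assume "0 < e"
      with h obtain y where "y \<in> I" "y < a + e" by (auto simp: least_bound_def)
      then show "(INF x\<in>I. ereal x) \<le> ereal a + ereal e"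
        by (intro INF_lower2[of y]) auto
    qed
  qed
qed

lemma left_end_uminus: "left_end (uminus ` I) = - right_end I"
  unfolding left_end_def right_end_def
  by (simp add: image_image ereal_INF_uminus_eq flip: uminus_ereal.simps)

lemma right_end_eq_ereal_iff:
  assumes "I \<noteq> {}"
  shows "right_end I = ereal b \<longleftrightarrow> greatest_bound I b"
proof -
  have "right_end I = ereal b \<longleftrightarrow> left_end (uminus ` I) = ereal (- b)"
    unfolding left_end_uminus by (metis ereal_uminus_uminus uminus_ereal.simps(1))
  then show ?thesis
    using assms by (simp add: left_end_eq_ereal_iff least_bound_uminus)
qed

section \<open>Cells: level sets of finite values and gaps of infinite ones\<close>

definition cell :: "real set \<Rightarrow> (real \<Rightarrow> real) \<Rightarrow> real \<Rightarrow> real set" where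
  "cell F l x = (if x \<in> F then {y \<in> F. l y = l x} else {y. {min x y..max x y} \<inter> F = {}})"

lemma mem_cell_self: "x \<in> cell F l x"
  by (auto simp: cell_def)

lemma cell_uminus: "cell (uminus ` F) (reflect T l) (- x) = uminus ` cell F l x"
proof (cases "x \<in> F")
  case True
  then show ?thesis by (auto simp: cell_def reflect_def)
next
  case False
  have "{min (- x) y..max (- x) y} = uminus ` {min x (- y)..max x (- y)}" for y
    by (auto simp: min_def max_def)
  then have "{min (- x) y..max (- x) y} \<inter> uminus ` F = uminus ` ({min x (- y)..max x (- y)} \<inter> F)" for y
    by (metis image_Int inj_uminus)
  then have "{min (- x) y..max (- x) y} \<inter> uminus ` F = {} \<longleftrightarrow> {min x (- y)..max x (- y)} \<inter> F = {}" for y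
    by simp
  with False show ?thesis by (auto simp: cell_def uminus_image_iff)
qed

lemma mem_cell_imp_mem_iff: "y \<in> cell F l x \<Longrightarrow> y \<in> F \<longleftrightarrow> x \<in> F"
  using max.cobounded2[of y x] min.cobounded2[of x y]
  by (auto simp: cell_def disjoint_iff split: if_splits)

lemma cell_eq:
  assumes "y \<in> cell F l x"
  shows "cell F l y = cell F l x"
proof (cases "x \<in> F")
  case True
  with assms show ?thesis by (auto simp: cell_def)
next
  case False
  then have y: "y \<notin> F" and d: "{min x y..max x y} \<inter> F = {}"
    using assms mem_cell_imp_mem_iff[OF assms] by (auto simp: cell_def)
  have "{min y z..max y z} \<inter> F = {} \<longleftrightarrow> {min x z..max x z} \<inter> F = {}" for z
  proof -
    \<comment> \<open>Of the three segments joining \<open>x\<close>, \<open>y\<close> and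
      \<open>z\<close>, each is covered by the other two.\<close>
    have "{min y z..max y z} \<subseteq> {min x y..max x y} \<union> {min x z..max x z}"
         "{min x z..max x z} \<subseteq> {min x y..max x y} \<union> {min y z..max y z}"
      by auto
    with d show ?thesis by blast
  qed
  then show ?thesis using False y by (simp add: cell_def)
qed

text \<open>Let \<open>a \<le> y \<le> b\<close> with common finite value \<open>d\<close> at
  \<open>a\<close> and \<open>b\<close>. Then \<open>d\<close> lies in the window of
  \<open>y\<close>, so the local condition applies from \<open>a\<close> and from \<open>b\<close>.
  If \<open>l y \<noteq> d\<close>, the first leaves only \<open>l y > a + T\<close> and the second
  only \<open>l y < b\<close>, against \<open>b \<le> d \<le> a + T\<close>.\<close>

lemma is_interval_cell:
  assumes "local_on T F l"
  shows "is_interval (cell F l x)"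
  unfolding is_interval_1
proof (intro ballI allI impI)
  fix a b y
  assume a: "a \<in> cell F l x" and b: "b \<in> cell F l x" and y: "a \<le> y \<and> y \<le> b"
  show "y \<in> cell F l x"
  proof (cases "x \<in> F")
    case True
    then have ab: "a \<in> F" "b \<in> F" "l a = l x" "l b = l x"
      using a b by (auto simp: cell_def)
    note bounds = local_on_bounds[OF assms ab(1)] local_on_bounds[OF assms ab(2)]
    have "y \<le> l a" "l a \<le> y + T" using ab bounds y by auto
    note ya = local_onD[OF assms ab(1) this]
    have "y \<le> l b" "l b \<le> y + T" using ab bounds y by auto
    note yb = local_onD[OF assms ab(2) this]
    have "l y = l x"
      using ya yb ab bounds y local_on_bounds[OF assms ya(1)] by auto
    with ya True show ?thesis by (simp add: cell_def)
  next
    case False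
    have "{min x y..max x y} \<subseteq> {min x a..max x a} \<union> {min x b..max x b}"
      using y by auto
    moreover have "({min x a..max x a} \<union> {min x b..max x b}) \<inter> F = {}"
      using a b False by (auto simp: cell_def)
    ultimately show ?thesis using False unfolding cell_def by auto
  qed
qed

text \<open>For a level set, its value stays in the window of \<open>a\<close> in the limit, so
  \<open>a\<close> is finite; \<open>l a\<close> differs from that value and is pushed below every
  point of the cell, hence down to \<open>a\<close>. For a gap, a value \<open>l a > a\<close> would
  make points just right of \<open>a\<close> finite.\<close>

lemma cell_open_left:
  assumes "T > 0" and loc: "local_on T F l" and lb: "least_bound (cell F l x) a"
    and out: "a \<notin> cell F l x"
  shows "a \<in> F" "l a = a"
proof -
  have lower: "a \<le> y" if "y \<in> cell F l x" for y using lb that by (auto simp: least_bound_def)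
  have approach: "\<exists>y\<in>cell F l x. y < a + e" if "e > 0" for e
    using lb that by (auto simp: least_bound_def)
  have ax: "a < x" using lower[OF mem_cell_self] mem_cell_self[of x F l] out by (metis order_le_less)
  have "a \<in> F \<and> l a = a"
  proof (cases "x \<in> F")
    case True
    then have mem: "y \<in> F \<and> l y = l x" if "y \<in> cell F l x" for y
      using that by (simp add: cell_def)
    have up: "l x \<le> a + T"
    proof (rule field_le_epsilon)
      fix e :: real assume "0 < e"
      from approach[OF this] obtain y where y: "y \<in> cell F l x" "y < a + e" by auto
      then show "l x \<le> a + T + e"
        using mem[OF y(1)] local_on_bounds[OF loc, of y] by auto
    qed
    have lo: "a \<le> l x" using ax local_on_bounds[OF loc True] by simp
    have aF: "a \<in> F" using local_onD[OF loc True lo up] by simp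
    have "l a \<noteq> l x" using out True aF by (simp add: cell_def)
    \<comment> \<open>The local condition from \<open>y\<close> keeps \<open>l a\<close> out of the
      window of \<open>y\<close>, and \<open>l a \<le> a + T \<le> y + T\<close> leaves only the
      lower side.\<close>
    have "l a < y" if y: "y \<in> cell F l x" for y
    proof -
      have "l a = l y \<or> l a < y \<or> y + T < l a"
        using local_onD(2)[OF loc, of y a] mem[OF y] lo up by simp
      with \<open>l a \<noteq> l x\<close> mem[OF y] lower[OF y] local_on_bounds(2)[OF loc aF] show ?thesis by auto
    qed
    then have "l a \<le> a + e" if "e > 0" for e using approach[OF that] by force
    then have "l a \<le> a" by (rule field_le_epsilon)
    with local_on_bounds[OF loc aF] aF show ?thesis by auto
  next
    case False
    have free: "z \<notin> F" if z: "a < z" "z \<le> x" for z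
    proof -
      obtain y where y: "y \<in> cell F l x" "y < z" using approach[of "z - a"] z by auto
      then have "{min x y..max x y} \<inter> F = {}" using False by (simp add: cell_def)
      moreover have "z \<in> {min x y..max x y}" using y z by auto
      ultimately show ?thesis by auto
    qed
    have aF: "a \<in> F"
    proof (rule ccontr)
      assume "a \<notin> F"
      have "z \<notin> F" if "a \<le> z" "z \<le> x" for z
        using free[of z] \<open>a \<notin> F\<close> that by (cases "z = a") auto
      then have "{min x a..max x a} \<inter> F = {}"
        using ax by auto
      then show False using out False by (simp add: cell_def)
    qed
    have "l a = a"
    proof (rule ccontr)
      assume "l a \<noteq> a"
      then have "a < l a" using local_on_bounds[OF loc aF] by simp
      \<comment> \<open>A point of the gap \<open>(a, x]\<close> whose window still contains
        \<open>l a\<close>, since \<open>b \<le> l a \<le> a + T \<le> b + T\<close>.\<close>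
      define b where "b = min (l a) (min x (a + T))"
      have b: "a < b" "b \<le> x" "b \<le> l a" "l a \<le> b + T"
        using \<open>a < l a\<close> ax \<open>T > 0\<close> local_on_bounds[OF loc aF] by (auto simp: b_def)
      show False using local_onD(1)[OF loc aF b(3,4)] free[OF b(1,2)] by simp
    qed
    with aF show ?thesis by simp
  qed
  then show "a \<in> F" "l a = a" by auto
qed

text \<open>Together with \<open>y \<le> l y\<close>, the bound \<open>l y \<le> a\<close> squeezes
  the displacement to 0 as \<open>y\<close> rises to \<open>a\<close>.\<close>

lemma cell_limit_left:
  assumes "T > 0" and loc: "local_on T F l" and lb: "least_bound (cell F l x) a"
    and neq: "\<not> (a \<in> F \<and> l a = a + T)"
  shows "\<exists>\<delta>>0. \<forall>y. a - \<delta> < y \<and> y < a \<longrightarrow> y \<in> F \<and> l y \<le> a"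
proof -
  have lower: "a \<le> y" if "y \<in> cell F l x" for y using lb that by (auto simp: least_bound_def)
  show ?thesis
  proof (cases "a \<in> F")
    case True
    then have pos: "a + T - l a > 0" using neq local_on_bounds[OF loc True] by simp
    \<comment> \<open>The slack \<open>a + T - l a\<close> keeps \<open>l a\<close> in the window of
      \<open>y\<close>. As \<open>l y \<le> y + T\<close> excludes values beyond
      \<open>a + T\<close>, only \<open>l y < a\<close> or \<open>l y = l a\<close> remains.\<close>
    have "y \<in> F \<and> l y \<le> a" if y: "a - (a + T - l a) < y" "y < a" for y
    proof -
      have *: "y \<le> l a" "l a \<le> y + T" using y local_on_bounds[OF loc True] by auto
      note ly = local_onD[OF loc True *]
      \<comment> \<open>Equal values with \<open>l a \<noteq> a\<close> would put \<open>a\<close>,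
        and with it \<open>y\<close>, into the cell, although \<open>y\<close> is below its
        infimum.\<close>
      have "l y = l a \<Longrightarrow> l a = a"
      proof (rule ccontr)
        assume eq: "l y = l a" and "l a \<noteq> a"
        then have "a \<in> cell F l x" using cell_open_left[OF \<open>T > 0\<close> loc lb] by auto
        then have "cell F l x = cell F l a" by (simp add: cell_eq)
        then have "y \<in> cell F l x" using True ly eq by (simp add: cell_def)
        then show False using lower y by force
      qed
      then show ?thesis using ly local_on_bounds[OF loc ly(1)] y by auto
    qed
    with pos show ?thesis by blast
  next
    case False
    then have "a \<in> cell F l x" using cell_open_left[OF \<open>T > 0\<close> loc lb] by auto
    then have cell: "cell F l x = cell F l a" by (simp add: cell_eq)
    \<comment> \<open>A value \<open>l z \<ge> a\<close> would lie in the window of \<open>a\<close>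
      and make \<open>a\<close> finite.\<close>
    have less: "l z < a" if z: "z \<in> F" "z < a" for z
    proof (rule ccontr)
      assume "\<not> l z < a"
      then show False
        using local_onD(1)[OF loc z(1), of a] local_on_bounds[OF loc z(1)] z False by auto
    qed
    have "y \<in> F \<and> l y \<le> a" if y: "a - T < y" "y < a" for y
    proof -
      \<comment> \<open>Being outside the gap of \<open>a\<close>, the point \<open>y\<close> has
        some \<open>z \<in> F\<close> between itself and \<open>a\<close>. Since
        \<open>y \<le> z \<le> l z < a < y + T\<close>, that value lies in the window of
        \<open>y\<close>.\<close>
      have "y \<notin> cell F l a" using lower y cell by force
      then obtain z where z: "z \<in> F" "y \<le> z" "z \<le> a"
        using False y by (auto simp: cell_def min_def max_def)
      then have "z < a" using False by (metis order_le_less)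
      have "y \<in> F"
        using local_onD(1)[OF loc z(1), of y] less[OF z(1) \<open>z < a\<close>] local_on_bounds[OF loc z(1)] z y
        by auto
      with less[OF this y(2)] show ?thesis by simp
    qed
    with \<open>T > 0\<close> show ?thesis by blast
  qed
qed

lemma cell_right:
  assumes "T > 0" and loc: "local_on T F l" and gb: "greatest_bound (cell F l x) b"
  shows "b \<notin> cell F l x \<Longrightarrow> b \<in> F \<and> l b = b + T"
    and "\<not> (b \<in> F \<and> l b = b) \<Longrightarrow> \<exists>\<delta>>0. \<forall>y. b < y \<and> y < b + \<delta> \<longrightarrow> y \<in> F \<and> b + T \<le> l y"
proof -
  note loc' = local_on_reflect[OF loc]
  have lb: "least_bound (cell (uminus ` F) (reflect T l) (- x)) (- b)"
    using gb by (simp add: cell_uminus least_bound_uminus)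
  show "b \<in> F \<and> l b = b + T" if "b \<notin> cell F l x"
    using cell_open_left[OF \<open>T > 0\<close> loc' lb] that by (simp_all add: cell_uminus reflect_def uminus_image_iff)
  assume "\<not> (b \<in> F \<and> l b = b)"
  then obtain \<delta> where d: "\<delta> > 0"
    "\<And>y. - b - \<delta> < y \<Longrightarrow> y < - b \<Longrightarrow> y \<in> uminus ` F \<and> reflect T l y \<le> - b"
    using cell_limit_left[OF \<open>T > 0\<close> loc' lb] by (force simp: reflect_def)
  have "y \<in> F \<and> b + T \<le> l y" if "b < y" "y < b + \<delta>" for y
    using d(2)[of "- y"] that by (auto simp: reflect_def)
  with d(1) show "\<exists>\<delta>>0. \<forall>y. b < y \<and> y < b + \<delta> \<longrightarrow> y \<in> F \<and> b + T \<le> l y" by blast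
qed


section \<open>The local condition recovered from the boundary behaviour of cells\<close>

text \<open>\<open>K x\<close> stands for the partition member containing \<open>x\<close>. The
  limits 0 and \<open>T\<close> of the displacement are written with one inequality each, since
  \<open>y \<le> l y \<le> y + T\<close> gives the other side.\<close>

definition regular_cells :: "real \<Rightarrow> real set \<Rightarrow> (real \<Rightarrow> real) \<Rightarrow> (real \<Rightarrow> real set) \<Rightarrow> bool" where
  "regular_cells T F l K \<longleftrightarrow>
     (\<forall>x\<in>F. x \<le> l x \<and> l x \<le> x + T) \<and>
     (\<forall>x. x \<in> K x \<and> is_interval (K x)) \<and>
     (\<forall>x. \<forall>y\<in>K x. (y \<in> F \<longleftrightarrow> x \<in> F) \<and> (x \<in> F \<longrightarrow> l y = l x)) \<and>
     (\<forall>x a. least_bound (K x) a \<longrightarrow>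
        (\<not> (a \<in> F \<and> l a = a + T) \<longrightarrow>
           (\<forall>e>0. \<exists>\<delta>>0. \<forall>y. a - \<delta> < y \<and> y < a \<longrightarrow> y \<in> F \<and> l y < y + e)) \<and>
        (a \<notin> K x \<longrightarrow> a \<in> F \<and> l a = a)) \<and>
     (\<forall>x b. greatest_bound (K x) b \<longrightarrow>
        (\<not> (b \<in> F \<and> l b = b) \<longrightarrow>
           (\<forall>e>0. \<exists>\<delta>>0. \<forall>y. b < y \<and> y < b + \<delta> \<longrightarrow> y \<in> F \<and> y + T - e < l y)) \<and>
        (b \<notin> K x \<longrightarrow> b \<in> F \<and> l b = b + T))"

context
  fixes T F l K
  assumes cells: "regular_cells T F l K"
begin

lemma regular_cells_bounds: "x \<in> F \<Longrightarrow> x \<le> l x \<and> l x \<le> x + T"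
  using cells by (simp add: regular_cells_def)

lemma regular_cells_self: "x \<in> K x"
  using cells by (simp add: regular_cells_def)

lemma regular_cells_between: "\<lbrakk>y \<in> K x; z \<in> K x; y \<le> u; u \<le> z\<rbrakk> \<Longrightarrow> u \<in> K x"
  using cells unfolding regular_cells_def is_interval_1 by blast

lemma regular_cells_const:
  assumes "y \<in> K x"
  shows "y \<in> F \<longleftrightarrow> x \<in> F" "x \<in> F \<Longrightarrow> l y = l x"
  using cells assms by (simp_all add: regular_cells_def)

lemma regular_cells_left_limit:
  assumes "least_bound (K x) a" "\<not> (a \<in> F \<and> l a = a + T)" "e > 0"
  obtains \<delta> where "\<delta> > 0" "\<And>y. a - \<delta> < y \<Longrightarrow> y < a \<Longrightarrow> y \<in> F \<and> l y < y + e"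
proof -
  have "\<exists>\<delta>>0. \<forall>y. a - \<delta> < y \<and> y < a \<longrightarrow> y \<in> F \<and> l y < y + e"
    using cells assms unfolding regular_cells_def by blast
  then show thesis using that by blast
qed

lemma regular_cells_right_limit:
  assumes "greatest_bound (K x) b" "\<not> (b \<in> F \<and> l b = b)" "e > 0"
  obtains \<delta> where "\<delta> > 0" "\<And>y. b < y \<Longrightarrow> y < b + \<delta> \<Longrightarrow> y \<in> F \<and> y + T - e < l y"
proof -
  have "\<exists>\<delta>>0. \<forall>y. b < y \<and> y < b + \<delta> \<longrightarrow> y \<in> F \<and> y + T - e < l y"
    using cells assms unfolding regular_cells_def by blast
  then show thesis using that by blast
qed

lemma regular_cells_left_open: "\<lbrakk>least_bound (K x) a; a \<notin> K x\<rbrakk> \<Longrightarrow> a \<in> F \<and> l a = a"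
  using cells unfolding regular_cells_def by blast

lemma regular_cells_right_open: "\<lbrakk>greatest_bound (K x) b; b \<notin> K x\<rbrakk> \<Longrightarrow> b \<in> F \<and> l b = b + T"
  using cells unfolding regular_cells_def by blast

end

lemma least_bound_Inf:
  assumes "I \<noteq> {}" "\<And>y. y \<in> I \<Longrightarrow> c \<le> y"
  shows "least_bound I (Inf I)" "c \<le> Inf I"
proof -
  have bdd: "bdd_below I" using assms(2) by (auto simp: bdd_below_def)
  have "\<exists>y\<in>I. y < Inf I + e" if "e > 0" for e
    using that cInf_less_iff[OF assms(1) bdd, of "Inf I + e"] by simp
  then show "least_bound I (Inf I)"
    using cInf_lower[OF _ bdd] by (simp add: least_bound_def)
  show "c \<le> Inf I" using assms by (rule cInf_greatest)
qed

lemma greatest_bound_Sup: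
  assumes "I \<noteq> {}" "\<And>y. y \<in> I \<Longrightarrow> y \<le> c"
  shows "greatest_bound I (Sup I)" "Sup I \<le> c"
proof -
  have bdd: "bdd_above I" using assms(2) by (auto simp: bdd_above_def)
  have "\<exists>y\<in>I. Sup I - e < y" if "e > 0" for e
    using that less_cSup_iff[OF assms(1) bdd, of "Sup I - e"] by simp
  then show "greatest_bound I (Sup I)"
    using cSup_upper[OF _ bdd] by (simp add: greatest_bound_def)
  show "Sup I \<le> c" using assms by (rule cSup_least)
qed

text \<open>Unless the value at the endpoint is exceptional, the displacement is near 0 just left of
  a left end and near \<open>T\<close> just right of a right end. Around the supremum
  \<open>s\<close> of the bad points the exceptions are ruled out. Then either two such descriptions
  overlap on an interval, where \<open>T/2\<close> separates them, or a bad point near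
  \<open>s\<close> gets a value below \<open>a\<close>.\<close>

lemma regular_cells_local_left:
  assumes "T > 0" and cells: "regular_cells T F l K" and aF: "a \<in> F" and "b < a" and le: "l a \<le> b + T"
  shows "b \<in> F \<and> (l b = l a \<or> l b < a)"
proof (rule ccontr)
  \<comment> \<open>The harmless values above \<open>a + T\<close> need no clause: \<open>l y \<le> y + T\<close> excludes them left of \<open>a\<close>.\<close>
  define bad where "bad y \<longleftrightarrow> y \<notin> F \<or> (a \<le> l y \<and> l y \<noteq> l a)" for y
  assume "\<not> ?thesis"
  then have "bad b" by (auto simp: bad_def)
  have "\<not> bad a" using aF by (simp add: bad_def)
  have al: "a \<le> l a" using regular_cells_bounds[OF cells aF] by simp
  note self = regular_cells_self[OF cells]
  note between = regular_cells_between[OF cells]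
  \<comment> \<open>Badness depends only on finiteness and value, both constant on a cell, so a cell
    is wholly bad or wholly good.\<close>
  have bad_cong: "bad y \<longleftrightarrow> bad x" if "y \<in> K x" for x y
    using regular_cells_const[OF cells that] by (auto simp: bad_def)
  define S where "S = {y. b \<le> y \<and> y \<le> a \<and> bad y}"
  define s where "s = Sup S"
  have bS: "b \<in> S" using \<open>bad b\<close> \<open>b < a\<close> by (simp add: S_def)
  then have ne: "S \<noteq> {}" by auto
  have bdd: "bdd_above S" by (auto simp: S_def bdd_above_def)
  have bs: "b \<le> s" unfolding s_def by (rule cSup_upper[OF bS bdd])
  have sa: "s \<le> a" unfolding s_def using ne by (rule cSup_least) (simp add: S_def)
  have S_le: "y \<le> s" if "y \<in> S" for y unfolding s_def by (rule cSup_upper[OF that bdd])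
  have good: "\<not> bad y" if "s < y" "y \<le> a" for y
    using S_le[of y] that bs by (auto simp: S_def)
  have approach: "\<exists>t\<in>S. y < t" if "y < s" for y
    using that less_cSup_iff[OF ne bdd] unfolding s_def by simp
  show False
  proof (cases "bad s")
    case True
    then have "s < a" using sa \<open>\<not> bad a\<close> by (metis order_le_less)
    \<comment> \<open>Points of \<open>(s, a]\<close> are good, so the cell of the bad point
      \<open>s\<close> ends at \<open>s\<close>.\<close>
    have "y \<le> s" if "y \<in> K s" for y
    proof (rule ccontr)
      assume "\<not> y \<le> s"
      then have "min y a \<in> K s" using between[OF self that] \<open>s < a\<close> by auto
      then show False using bad_cong[of "min y a" s] True good[of "min y a"] \<open>\<not> y \<le> s\<close> \<open>s < a\<close> by auto
    qed
    then have gb: "greatest_bound (K s) s"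
      using self[of s] by (auto simp: greatest_bound_def intro!: bexI[of _ s])
    \<comment> \<open>A finite bad value is at least \<open>a\<close>, hence above
      \<open>s\<close>.\<close>
    have ns: "\<not> (s \<in> F \<and> l s = s)" using True \<open>s < a\<close> by (auto simp: bad_def)
    obtain \<delta> where "\<delta> > 0" and \<delta>: "\<And>y. s < y \<Longrightarrow> y < s + \<delta> \<Longrightarrow> y \<in> F \<and> y + T - T/2 < l y"
      using regular_cells_right_limit[OF cells gb ns, of "T/2"] \<open>T > 0\<close> by auto
    \<comment> \<open>A point right of \<open>s\<close>, short of both \<open>a\<close> and
      \<open>s + \<delta>\<close>. Its cell starts at some \<open>k\<close>, which turns out to lie
      strictly right of \<open>s\<close>.\<close>
    define x where "x = s + min \<delta> (a - s) / 2"
    have x: "s < x" "x < a" "x < s + \<delta>"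
      using \<open>\<delta> > 0\<close> \<open>s < a\<close> by (auto simp: x_def min_def field_simps)
    have "s \<notin> K x" using bad_cong[of s x] True good[of x] x by auto
    then have above: "s \<le> y" if "y \<in> K x" for y
      using between[OF that self[of x], of s] x by fastforce
    define k where "k = Inf (K x)"
    have lb: "least_bound (K x) k" and "s \<le> k"
      using least_bound_Inf[of "K x" s] above self[of x] by (auto simp: k_def)
    have "k \<le> x" using lb self[of x] by (simp add: least_bound_def)
    \<comment> \<open>If \<open>k = s\<close>, the cell of \<open>x\<close> would be open at
      \<open>s\<close>, forcing \<open>l s = s\<close>.\<close>
    have "k \<noteq> s" using regular_cells_left_open[OF cells lb] \<open>s \<notin> K x\<close> ns by auto
    with \<open>s \<le> k\<close> have "s < k" by simp
    then have kF: "k \<in> F" "k + T - T/2 < l k" using \<delta>[of k] \<open>k \<le> x\<close> x by auto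
    \<comment> \<open>Goodness gives \<open>l k \<le> l a \<le> b + T < k + T\<close>, so just left
      of \<open>k\<close> the displacement falls below \<open>T/2\<close>, while on
      \<open>(s, k)\<close> it exceeds \<open>T/2\<close>.\<close>
    have "l k \<le> l a" using good[of k] \<open>s < k\<close> \<open>k \<le> x\<close> x kF al by (auto simp: bad_def)
    then have "\<not> (k \<in> F \<and> l k = k + T)" using le bs \<open>s < k\<close> by auto
    then obtain \<delta>' where "\<delta>' > 0" and \<delta>': "\<And>y. k - \<delta>' < y \<Longrightarrow> y < k \<Longrightarrow> y \<in> F \<and> l y < y + T/2"
      using regular_cells_left_limit[OF cells lb, of "T/2"] \<open>T > 0\<close> by auto
    define y where "y = max (k - \<delta>'/2) ((s + k)/2)"
    have "s < y" "y < k" "k - \<delta>' < y"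
      using \<open>s < k\<close> \<open>\<delta>' > 0\<close> by (auto simp: y_def max_def field_simps)
    then show False using \<delta>[of y] \<delta>'[of y] x \<open>k \<le> x\<close> by auto
  next
    case False
    then have "b < s" using bs \<open>bad b\<close> by (metis order_le_less)
    have sF: "s \<in> F" "l s \<le> l a" using False al by (auto simp: bad_def)
    \<comment> \<open>A cell of \<open>s\<close> reaching below \<open>s\<close> would contain bad
      points, since these accumulate at \<open>s\<close> from below.\<close>
    have "s \<le> y" if y: "y \<in> K s" for y
    proof (rule ccontr)
      assume "\<not> s \<le> y"
      then obtain t where "t \<in> S" "y < t" using approach[of y] by auto
      then have "t \<in> K s" using between[OF y self] S_le by auto
      with False \<open>t \<in> S\<close> show False using bad_cong[of t s] by (simp add: S_def)
    qed
    then have lb: "least_bound (K s) s"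
      using self[of s] by (auto simp: least_bound_def intro!: bexI[of _ s])
    have ns: "\<not> (s \<in> F \<and> l s = s + T)" using sF le \<open>b < s\<close> by auto
    have step: "\<exists>t\<in>S. s - \<delta> < t \<and> t < s" if "\<delta> > 0" for \<delta>
    proof -
      obtain t where t: "t \<in> S" "s - \<delta> < t" using approach[of "s - \<delta>"] \<open>\<delta> > 0\<close> by auto
      then have "t \<noteq> s" using False by (auto simp: S_def)
      with t S_le[of t] show ?thesis by force
    qed
    show False
    proof (cases "s < a")
      case True
      \<comment> \<open>With tolerance \<open>a - s\<close>, a point \<open>t\<close> just left of
        \<open>s\<close> is finite with \<open>l t < t + (a - s) < a\<close>, so it is not
        bad.\<close>
      obtain \<delta> where "\<delta> > 0" and \<delta>: "\<And>y. s - \<delta> < y \<Longrightarrow> y < s \<Longrightarrow> y \<in> F \<and> l y < y + (a - s)"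
        using regular_cells_left_limit[OF cells lb ns, of "a - s"] True by auto
      obtain t where "t \<in> S" "s - \<delta> < t" "t < s" using step[OF \<open>\<delta> > 0\<close>] by auto
      then show False using \<delta>[of t] by (auto simp: S_def bad_def)
    next
      case False
      with sa have "s = a" by simp
      obtain \<delta> where "\<delta> > 0" and \<delta>: "\<And>y. a - \<delta> < y \<Longrightarrow> y < a \<Longrightarrow> y \<in> F \<and> l y < y + T/2"
        using regular_cells_left_limit[OF cells lb ns, of "T/2"] \<open>T > 0\<close> \<open>s = a\<close> by auto
      obtain t where t: "t \<in> S" "a - \<delta> < t" "t < a" using step[OF \<open>\<delta> > 0\<close>] \<open>s = a\<close> by auto
      then have tF: "t \<in> F" "a \<le> l t" using \<delta>[of t] by (auto simp: S_def bad_def)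
      \<comment> \<open>The cell of the bad point \<open>t\<close> excludes the good point
        \<open>a\<close>, so it ends at some \<open>r \<le> a\<close>.\<close>
      have "a \<notin> K t" using bad_cong[of a t] \<open>\<not> bad a\<close> t by (auto simp: S_def)
      then have below: "y \<le> a" if "y \<in> K t" for y
        using between[OF self[of t] that, of a] t by fastforce
      define r where "r = Sup (K t)"
      have gb: "greatest_bound (K t) r" and "r \<le> a"
        using greatest_bound_Sup[of "K t" a] below self[of t] by (auto simp: r_def)
      have "t \<le> r" using gb self[of t] by (simp add: greatest_bound_def)
      \<comment> \<open>If \<open>r = a\<close>, the cell of \<open>t\<close> would be open at
        \<open>a\<close>, forcing \<open>l a = a + T\<close> against
        \<open>l a \<le> b + T < a + T\<close>.\<close>
      have "r \<noteq> a" using regular_cells_right_open[OF cells gb] \<open>a \<notin> K t\<close> le \<open>b < a\<close> by auto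
      with \<open>r \<le> a\<close> have "r < a" by simp
      have rF: "r \<in> F" "l r < r + T/2" using \<delta>[of r] t \<open>t \<le> r\<close> \<open>r < a\<close> by auto
      \<comment> \<open>A cell open at \<open>r\<close> would need \<open>l r = r + T\<close>. Hence
        \<open>l r = l t \<ge> a > r\<close>, so just right of \<open>r\<close> the displacement
        exceeds \<open>T/2\<close>, against the bound \<open>T/2\<close> on
        \<open>(r, a)\<close>.\<close>
      then have "r \<in> K t" using regular_cells_right_open[OF cells gb] \<open>T > 0\<close> by force
      then have "l r = l t" using regular_cells_const[OF cells] tF by blast
      then have "\<not> (r \<in> F \<and> l r = r)" using tF \<open>r < a\<close> by auto
      then obtain \<delta>' where "\<delta>' > 0" and \<delta>': "\<And>y. r < y \<Longrightarrow> y < r + \<delta>' \<Longrightarrow> y \<in> F \<and> y + T - T/2 < l y"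
        using regular_cells_right_limit[OF cells gb, of "T/2"] \<open>T > 0\<close> by auto
      define y where "y = min (r + \<delta>'/2) ((r + a)/2)"
      have "r < y" "y < a" "y < r + \<delta>'"
        using \<open>r < a\<close> \<open>\<delta>' > 0\<close> by (auto simp: y_def min_def field_simps)
      then show False using \<delta>[of y] \<delta>'[of y] t \<open>t \<le> r\<close> by auto
    qed
  qed
qed

lemma regular_cells_reflect:
  assumes cells: "regular_cells T F l K"
  shows "regular_cells T (uminus ` F) (reflect T l) (\<lambda>x. uminus ` K (- x))"
  unfolding regular_cells_def uminus_image_iff least_bound_uminus greatest_bound_uminus
proof (intro conjI allI ballI impI; (elim conjE)?)
  fix x assume "x \<in> uminus ` F"
  then have "- x \<in> F" by (simp add: uminus_image_iff)
  then show "x \<le> reflect T l x" "reflect T l x \<le> x + T"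
    using regular_cells_bounds[OF cells, of "- x"] by (auto simp: reflect_def)
next
  fix x show "- x \<in> K (- x)" by (rule regular_cells_self[OF cells])
next
  fix x show "is_interval (uminus ` K (- x))"
    unfolding is_interval_1
  proof (intro ballI allI impI)
    fix a b y assume "a \<in> uminus ` K (- x)" "b \<in> uminus ` K (- x)" "a \<le> y \<and> y \<le> b"
    then show "y \<in> uminus ` K (- x)"
      using regular_cells_between[OF cells, of "- b" "- x" "- a" "- y"]
      by (simp add: uminus_image_iff)
  qed
next
  fix x y assume "y \<in> uminus ` K (- x)"
  then have y: "- y \<in> K (- x)" by (simp add: uminus_image_iff)
  show "- y \<in> F \<longleftrightarrow> - x \<in> F" by (rule regular_cells_const[OF cells y])
  show "reflect T l y = reflect T l x" if "- x \<in> F"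
    using regular_cells_const(2)[OF cells y that] by (simp add: reflect_def)
next
  fix x a e :: real
  assume gb: "greatest_bound (K (- x)) (- a)" and "e > 0"
    and "\<not> (- a \<in> F \<and> reflect T l a = a + T)"
  then have "\<not> (- a \<in> F \<and> l (- a) = - a)" by (auto simp: reflect_def)
  from regular_cells_right_limit[OF cells gb this \<open>e > 0\<close>] obtain \<delta> where \<delta>: "\<delta> > 0"
    "\<And>y. - a < y \<Longrightarrow> y < - a + \<delta> \<Longrightarrow> y \<in> F \<and> y + T - e < l y" by blast
  have "- y \<in> F \<and> reflect T l y < y + e" if "a - \<delta> < y" "y < a" for y
    using \<delta>(2)[of "- y"] that by (auto simp: reflect_def)
  with \<delta>(1) show "\<exists>\<delta>>0. \<forall>y. a - \<delta> < y \<and> y < a \<longrightarrow> - y \<in> F \<and> reflect T l y < y + e"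
    by blast
next
  fix x a :: real
  assume "greatest_bound (K (- x)) (- a)" "- a \<notin> K (- x)"
  from regular_cells_right_open[OF cells this]
  show "- a \<in> F" "reflect T l a = a" by (auto simp: reflect_def)
next
  fix x b e :: real
  assume lb: "least_bound (K (- x)) (- b)" and "e > 0"
    and "\<not> (- b \<in> F \<and> reflect T l b = b)"
  then have "\<not> (- b \<in> F \<and> l (- b) = - b + T)" by (auto simp: reflect_def)
  from regular_cells_left_limit[OF cells lb this \<open>e > 0\<close>] obtain \<delta> where \<delta>: "\<delta> > 0"
    "\<And>y. - b - \<delta> < y \<Longrightarrow> y < - b \<Longrightarrow> y \<in> F \<and> l y < y + e" by blast
  have "- y \<in> F \<and> y + T - e < reflect T l y" if "b < y" "y < b + \<delta>" for y
    using \<delta>(2)[of "- y"] that by (auto simp: reflect_def)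
  with \<delta>(1) show "\<exists>\<delta>>0. \<forall>y. b < y \<and> y < b + \<delta> \<longrightarrow> - y \<in> F \<and> y + T - e < reflect T l y"
    by blast
next
  fix x b :: real
  assume "least_bound (K (- x)) (- b)" "- b \<notin> K (- x)"
  from regular_cells_left_open[OF cells this]
  show "- b \<in> F" "reflect T l b = b + T" by (auto simp: reflect_def)
qed

lemma local_on_if_regular_cells:
  assumes "T > 0" and cells: "regular_cells T F l K"
  shows "local_on T F l"
  unfolding local_on_def
proof (intro conjI allI ballI impI)
  fix x assume "x \<in> F"
  then show "x \<le> l x" "l x \<le> x + T" using regular_cells_bounds[OF cells] by auto
next
  fix a b assume a: "a \<in> F" and b: "b \<le> l a \<and> l a \<le> b + T"
  consider "b < a" | "b = a" | "a < b" by linarith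
  then have "b \<in> F \<and> (l b = l a \<or> l b < a \<or> a + T < l b)"
  proof cases
    case 1
    with regular_cells_local_left[OF assms a] b show ?thesis by blast
  next
    case 2
    with a show ?thesis by simp
  next
    case 3
    \<comment> \<open>After reflection \<open>- b\<close> lies left of \<open>- a\<close>, the
      assumption \<open>b \<le> l a\<close> becomes the required upper bound, and
      \<open>reflect T l (- b) < - a\<close> reads \<open>a + T < l b\<close>.\<close>
    then have "- b \<in> uminus ` F \<and>
        (reflect T l (- b) = reflect T l (- a) \<or> reflect T l (- b) < - a)"
      using b a
      by (intro regular_cells_local_left[OF \<open>T > 0\<close> regular_cells_reflect[OF cells]])
        (auto simp: reflect_def)
    then show ?thesis by (auto simp: reflect_def)
  qed
  then show "b \<in> F" "l b = l a \<or> l b < a \<or> a + T < l b" by auto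
qed

section \<open>Extended-real maps as partially defined real functions\<close>

text \<open>Every extended-real map avoiding minus infinity has this form, so pieces and limits can
  be handled over the reals.\<close>

definition extend_infinity :: "real set \<Rightarrow> (real \<Rightarrow> real) \<Rightarrow> real \<Rightarrow> ereal" where
  "extend_infinity F l x = (if x \<in> F then ereal (l x) else \<infinity>)"

lemma ex_extend_infinity:
  assumes "\<And>x. L x \<noteq> - \<infinity>"
  obtains F l where "L = extend_infinity F l"
proof
  show "L = extend_infinity {x. L x \<noteq> \<infinity>} (\<lambda>x. real_of_ereal (L x))"
    using assms by (auto simp: extend_infinity_def fun_eq_iff ereal_real)
qed

lemma local_on_iff:
  assumes "L = extend_infinity F l"
  shows "local_on T F l \<longleftrightarrow>
    (\<forall>a. L a \<in> {ereal a..ereal (a + T)} \<union> {\<infinity>}) \<and>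
    (\<forall>a b. L a \<in> {ereal b..ereal (b + T)} \<longrightarrow>
        L b = L a \<or> L b \<in> {ereal b..ereal (b + T)} - {ereal a..ereal (a + T)})"
    (is "_ \<longleftrightarrow> ?R")
proof
  assume loc: "local_on T F l"
  show ?R
  proof (intro conjI allI impI)
    fix a show "L a \<in> {ereal a..ereal (a + T)} \<union> {\<infinity>}"
      using local_on_bounds[OF loc, of a] by (auto simp: assms extend_infinity_def)
  next
    fix a b assume "L a \<in> {ereal b..ereal (b + T)}"
    then have a: "a \<in> F" "b \<le> l a" "l a \<le> b + T"
      by (auto simp: assms extend_infinity_def split: if_splits)
    show "L b = L a \<or> L b \<in> {ereal b..ereal (b + T)} - {ereal a..ereal (a + T)}"
      using local_onD[OF loc a] local_on_bounds[OF loc, of b] a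
      by (auto simp: assms extend_infinity_def)
  qed
next
  assume R: ?R
  show "local_on T F l"
    unfolding local_on_def
  proof (intro conjI allI ballI impI)
    fix x assume "x \<in> F"
    then show "x \<le> l x" "l x \<le> x + T"
      using conjunct1[OF R, rule_format, of x] by (auto simp: assms extend_infinity_def)
  next
    fix a b assume "a \<in> F" "b \<le> l a \<and> l a \<le> b + T"
    then show "b \<in> F" "l b = l a \<or> l b < a \<or> a + T < l b"
      using conjunct2[OF R, rule_format, of a b]
      by (auto simp: assms extend_infinity_def split: if_splits)
  qed
qed

lemma displacement_extend_infinity:
  assumes "L f = extend_infinity F l"
  shows "displacement L f = extend_infinity F (\<lambda>x. l x - x)"
  by (auto simp: displacement_def assms extend_infinity_def)

lemma infinite_piece_extend_infinity:
  "infinite_piece (extend_infinity F h) I \<longleftrightarrow> I \<inter> F = {}"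
  by (auto simp: infinite_piece_def extend_infinity_def)

text \<open>The endpoint bounds on \<open>d\<close> hold exactly when they hold at every point of
  \<open>I\<close>, and they imply the length bound through
  \<open>right_end I \<le> d \<le> left_end I + T\<close>.\<close>

lemma linear_piece_extend_infinity:
  assumes "I \<noteq> {}"
  shows "linear_piece T (extend_infinity F (\<lambda>x. l x - x)) I \<longleftrightarrow>
    (\<exists>d. \<forall>x\<in>I. x \<in> F \<and> l x = d \<and> x \<le> d \<and> d \<le> x + T)"
proof -
  have right: "right_end I \<le> ereal d \<longleftrightarrow> (\<forall>x\<in>I. x \<le> d)" for d
    by (simp add: right_end_def SUP_le_iff)
  have "ereal d \<le> left_end I + ereal T \<longleftrightarrow> ereal (d - T) \<le> left_end I" for d
    by (cases "left_end I") auto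
  then have left: "ereal d \<le> left_end I + ereal T \<longleftrightarrow> (\<forall>x\<in>I. d \<le> x + T)" for d
    by (simp add: left_end_def le_INF_iff algebra_simps)
  have len: "right_end I - left_end I \<le> ereal T"
    if "right_end I \<le> ereal d" "ereal d \<le> left_end I + ereal T" for d
    using that by (cases "left_end I"; cases "right_end I") auto
  have val: "extend_infinity F (\<lambda>x. l x - x) x = ereal (d - x) \<longleftrightarrow> x \<in> F \<and> l x = d" for x d
    by (simp add: extend_infinity_def)
  show ?thesis
    unfolding linear_piece_def val using len left right by blast
qed

text \<open>A nonempty member cannot be finite throughout and infinite throughout, so the exclusive
  alternative becomes a plain disjunction.\<close>

lemma piecewise_linear_partition_extend_infinity:
  "piecewise_linear_partition T (extend_infinity F (\<lambda>x. l x - x)) P \<longleftrightarrow>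
     partition_on UNIV P \<and>
     (\<forall>I\<in>P. is_interval I \<and>
        ((\<exists>d. \<forall>x\<in>I. x \<in> F \<and> l x = d \<and> x \<le> d \<and> d \<le> x + T) \<or> I \<inter> F = {}))"
    (is "_ \<longleftrightarrow> _ \<and> (\<forall>I\<in>P. _ \<and> (?lin I \<or> _))")
proof (cases "partition_on UNIV P")
  case True
  have lin: "linear_piece T (extend_infinity F (\<lambda>x. l x - x)) I \<longleftrightarrow> ?lin I"
    and excl: "\<not> (?lin I \<and> I \<inter> F = {})" if "I \<in> P" for I
  proof -
    have "I \<noteq> {}" using True that by (auto simp: partition_on_def)
    then show "linear_piece T (extend_infinity F (\<lambda>x. l x - x)) I \<longleftrightarrow> ?lin I"
      by (rule linear_piece_extend_infinity)
    show "\<not> (?lin I \<and> I \<inter> F = {})" using \<open>I \<noteq> {}\<close> by blast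
  qed
  have eq: "is_interval I \<and>
      (linear_piece T (extend_infinity F (\<lambda>x. l x - x)) I \<and> I \<inter> F \<noteq> {} \<or>
       \<not> linear_piece T (extend_infinity F (\<lambda>x. l x - x)) I \<and> I \<inter> F = {}) \<longleftrightarrow>
      is_interval I \<and> (?lin I \<or> I \<inter> F = {})" if "I \<in> P" for I
    unfolding lin[OF that] using excl[OF that] by argo
  show ?thesis
    unfolding piecewise_linear_partition_def infinite_piece_extend_infinity
    by (intro conj_cong refl ball_cong eq)
qed (simp add: piecewise_linear_partition_def)

text \<open>Small neighbourhoods of a finite limit exclude infinity, so convergence to
  \<open>ereal c\<close> includes being eventually in \<open>F\<close>.\<close>

lemma tendsto_extend_infinity_iff:
  "(extend_infinity F h \<longlongrightarrow> ereal c) G \<longleftrightarrow>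
     (\<forall>e>0. eventually (\<lambda>x. x \<in> F \<and> \<bar>h x - c\<bar> < e) G)"
proof
  assume lim: "(extend_infinity F h \<longlongrightarrow> ereal c) G"
  show "\<forall>e>0. eventually (\<lambda>x. x \<in> F \<and> \<bar>h x - c\<bar> < e) G"
  proof (intro allI impI)
    fix e :: real assume "e > 0"
    then have "eventually (\<lambda>x. ereal (c - e) < extend_infinity F h x) G"
      "eventually (\<lambda>x. extend_infinity F h x < ereal (c + e)) G"
      using order_tendstoD[OF lim] by auto
    then show "eventually (\<lambda>x. x \<in> F \<and> \<bar>h x - c\<bar> < e) G"
      by eventually_elim (auto simp: extend_infinity_def split: if_splits)
  qed
next
  assume ev: "\<forall>e>0. eventually (\<lambda>x. x \<in> F \<and> \<bar>h x - c\<bar> < e) G"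
  have "(h \<longlongrightarrow> c) G"
    unfolding tendsto_iff
  proof (intro allI impI)
    fix e :: real assume "e > 0"
    with ev have "eventually (\<lambda>x. x \<in> F \<and> \<bar>h x - c\<bar> < e) G" by blast
    then show "eventually (\<lambda>x. dist (h x) c < e) G"
      by eventually_elim (simp add: dist_real_def)
  qed
  then have lim: "((\<lambda>x. ereal (h x)) \<longlongrightarrow> ereal c) G" by simp
  have "eventually (\<lambda>x. x \<in> F \<and> \<bar>h x - c\<bar> < 1) G" using ev by simp
  then have "eventually (\<lambda>x. extend_infinity F h x = ereal (h x)) G"
    by eventually_elim (simp add: extend_infinity_def)
  from tendsto_cong[OF this] lim show "(extend_infinity F h \<longlongrightarrow> ereal c) G" by simp
qed

lemma tendsto_at_left_extend_infinity_iff: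
  "(extend_infinity F h \<longlongrightarrow> ereal c) (at_left a) \<longleftrightarrow>
     (\<forall>e>0. \<exists>\<delta>>0. \<forall>y. a - \<delta> < y \<and> y < a \<longrightarrow> y \<in> F \<and> \<bar>h y - c\<bar> < e)"
proof -
  have "eventually P (at_left a) \<longleftrightarrow> (\<exists>\<delta>>0. \<forall>y. a - \<delta> < y \<and> y < a \<longrightarrow> P y)" for P
    unfolding eventually_at_left_field
  proof (intro iffI; elim exE conjE)
    fix b assume "b < a" "\<forall>y>b. y < a \<longrightarrow> P y"
    then show "\<exists>\<delta>>0. \<forall>y. a - \<delta> < y \<and> y < a \<longrightarrow> P y" by (intro exI[of _ "a - b"]) auto
  next
    fix \<delta> :: real assume "0 < \<delta>" "\<forall>y. a - \<delta> < y \<and> y < a \<longrightarrow> P y"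
    then show "\<exists>b<a. \<forall>y>b. y < a \<longrightarrow> P y" by (intro exI[of _ "a - \<delta>"]) auto
  qed
  then show ?thesis by (simp add: tendsto_extend_infinity_iff)
qed

lemma tendsto_at_right_extend_infinity_iff:
  "(extend_infinity F h \<longlongrightarrow> ereal c) (at_right a) \<longleftrightarrow>
     (\<forall>e>0. \<exists>\<delta>>0. \<forall>y. a < y \<and> y < a + \<delta> \<longrightarrow> y \<in> F \<and> \<bar>h y - c\<bar> < e)"
proof -
  have "eventually P (at_right a) \<longleftrightarrow> (\<exists>\<delta>>0. \<forall>y. a < y \<and> y < a + \<delta> \<longrightarrow> P y)" for P
    unfolding eventually_at_right_field
  proof (intro iffI; elim exE conjE)
    fix b assume "a < b" "\<forall>y>a. y < b \<longrightarrow> P y"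
    then show "\<exists>\<delta>>0. \<forall>y. a < y \<and> y < a + \<delta> \<longrightarrow> P y" by (intro exI[of _ "b - a"]) auto
  next
    fix \<delta> :: real assume "0 < \<delta>" "\<forall>y. a < y \<and> y < a + \<delta> \<longrightarrow> P y"
    then show "\<exists>b>a. \<forall>y>a. y < b \<longrightarrow> P y" by (intro exI[of _ "a + \<delta>"]) auto
  qed
  then show ?thesis by (simp add: tendsto_extend_infinity_iff)
qed

section \<open>The cells as roughest partition, with their boundary limits\<close>

lemma partition_on_cells: "partition_on UNIV (range (cell F l))"
proof (rule partition_onI)
  show "\<Union> (range (cell F l)) = UNIV" using mem_cell_self by blast
  show "{} \<notin> range (cell F l)" using mem_cell_self by blast
  fix p q assume "p \<in> range (cell F l)" "q \<in> range (cell F l)" "p \<noteq> q"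
  then show "disjnt p q" unfolding disjnt_iff by (metis cell_eq imageE)
qed

text \<open>A member of a competing partition either has a common value \<open>d\<close> and lies in
  one level set, or is an interval missing \<open>F\<close>; then the segments between its points
  miss \<open>F\<close> too, and it lies in one gap.\<close>

lemma roughest_cells:
  assumes loc: "local_on T F l"
  shows "roughest (piecewise_linear_partition T (extend_infinity F (\<lambda>x. l x - x))) (range (cell F l))"
  unfolding roughest_def piecewise_linear_partition_extend_infinity refines_def
proof (intro conjI allI ballI impI partition_on_cells; (elim conjE)?)
  fix I assume "I \<in> range (cell F l)"
  then obtain x where I: "I = cell F l x" by auto
  show "is_interval I" unfolding I by (rule is_interval_cell[OF loc])
  show "(\<exists>d. \<forall>x\<in>I. x \<in> F \<and> l x = d \<and> x \<le> d \<and> d \<le> x + T) \<or> I \<inter> F = {}"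
  proof (cases "x \<in> F")
    case True
    have "y \<in> F \<and> l y = l x \<and> y \<le> l x \<and> l x \<le> y + T" if "y \<in> I" for y
      using that True local_on_bounds[OF loc, of y] unfolding I by (auto simp: cell_def)
    then show ?thesis by blast
  next
    case False
    then show ?thesis unfolding I using mem_cell_imp_mem_iff by blast
  qed
next
  fix Q X
  assume Q: "partition_on UNIV Q" "X \<in> Q"
    and pieces: "\<forall>I\<in>Q. is_interval I \<and>
        ((\<exists>d. \<forall>x\<in>I. x \<in> F \<and> l x = d \<and> x \<le> d \<and> d \<le> x + T) \<or> I \<inter> F = {})"
  then obtain x where x: "x \<in> X" by (metis partition_on_def ex_in_conv)
  have "y \<in> cell F l x" if y: "y \<in> X" for y
  proof (cases "X \<inter> F = {}")
    case True
    have "is_interval X" using pieces Q(2) by blast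
    then have "z \<in> X" if "min x y \<le> z" "z \<le> max x y" for z
      using mem_is_interval_1_I[of X x y z] mem_is_interval_1_I[of X y x z] x y that
      by (cases "x \<le> y") (simp_all add: min_def max_def)
    then have "{min x y..max x y} \<subseteq> X" by auto
    with True x show ?thesis unfolding cell_def by auto
  next
    case False
    then obtain d where "\<forall>x\<in>X. x \<in> F \<and> l x = d" using bspec[OF pieces Q(2)] by auto
    with x y show ?thesis by (simp add: cell_def)
  qed
  then have "X \<subseteq> cell F l x" by (rule subsetI)
  then show "\<exists>Y\<in>range (cell F l). X \<subseteq> Y" by (rule bexI[OF _ rangeI])
qed

lemma boundary_conditions_cells:
  assumes "T > 0" and loc: "local_on T F l"
  shows "boundary_conditions T (extend_infinity F (\<lambda>x. l x - x)) (range (cell F l))"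
  unfolding boundary_conditions_def
proof (intro ballI allI conjI impI)
  fix I a assume "I \<in> range (cell F l)" and "left_end I = ereal a"
  then obtain x where I: "I = cell F l x" and lb: "least_bound (cell F l x) a"
    using left_end_eq_ereal_iff mem_cell_self by (metis empty_iff imageE)
  show "extend_infinity F (\<lambda>x. l x - x) a = 0" if "a \<notin> I"
    using cell_open_left[OF assms lb] that by (simp add: I extend_infinity_def)
  assume "extend_infinity F (\<lambda>x. l x - x) a \<noteq> ereal T"
  then have "\<not> (a \<in> F \<and> l a = a + T)" by (auto simp: extend_infinity_def)
  from cell_limit_left[OF assms lb this] obtain \<delta> where "\<delta> > 0"
    and \<delta>: "\<And>y. a - \<delta> < y \<Longrightarrow> y < a \<Longrightarrow> y \<in> F \<and> l y \<le> a" by blast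
  have "(extend_infinity F (\<lambda>x. l x - x) \<longlongrightarrow> ereal 0) (at_left a)"
    unfolding tendsto_at_left_extend_infinity_iff
  proof (intro allI impI)
    fix e :: real assume "e > 0"
    \<comment> \<open>From \<open>y \<le> l y \<le> a\<close> the displacement is at most
      \<open>a - y\<close>, which the minimum with \<open>e\<close> keeps below
      \<open>e\<close>.\<close>
    have "y \<in> F \<and> \<bar>l y - y - 0\<bar> < e" if "a - min \<delta> e < y" "y < a" for y
      using \<delta>[of y] that local_on_bounds[OF loc, of y] by (auto simp: min_def split: if_splits)
    then show "\<exists>\<delta>>0. \<forall>y. a - \<delta> < y \<and> y < a \<longrightarrow> y \<in> F \<and> \<bar>l y - y - 0\<bar> < e"
      using \<open>\<delta> > 0\<close> \<open>e > 0\<close> by (intro exI[of _ "min \<delta> e"]) auto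
  qed
  then show "(extend_infinity F (\<lambda>x. l x - x) \<longlongrightarrow> 0) (at_left a)" by (simp add: zero_ereal_def)
next
  fix I b assume "I \<in> range (cell F l)" and "right_end I = ereal b"
  then obtain x where I: "I = cell F l x" and gb: "greatest_bound (cell F l x) b"
    using right_end_eq_ereal_iff mem_cell_self by (metis empty_iff imageE)
  show "extend_infinity F (\<lambda>x. l x - x) b = ereal T" if "b \<notin> I"
    using cell_right(1)[OF assms gb] that by (simp add: I extend_infinity_def)
  assume "extend_infinity F (\<lambda>x. l x - x) b \<noteq> 0"
  then have "\<not> (b \<in> F \<and> l b = b)" by (auto simp: extend_infinity_def)
  from cell_right(2)[OF assms gb this] obtain \<delta> where "\<delta> > 0"
    and \<delta>: "\<And>y. b < y \<Longrightarrow> y < b + \<delta> \<Longrightarrow> y \<in> F \<and> b + T \<le> l y" by blast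
  show "(extend_infinity F (\<lambda>x. l x - x) \<longlongrightarrow> ereal T) (at_right b)"
    unfolding tendsto_at_right_extend_infinity_iff
  proof (intro allI impI)
    fix e :: real assume "e > 0"
    \<comment> \<open>From \<open>b + T \<le> l y \<le> y + T\<close> the displacement differs from
      \<open>T\<close> by at most \<open>y - b < e\<close>.\<close>
    have "y \<in> F \<and> \<bar>l y - y - T\<bar> < e" if "b < y" "y < b + min \<delta> e" for y
      using \<delta>[of y] that local_on_bounds[OF loc, of y] by (auto simp: min_def split: if_splits)
    then show "\<exists>\<delta>>0. \<forall>y. b < y \<and> y < b + \<delta> \<longrightarrow> y \<in> F \<and> \<bar>l y - y - T\<bar> < e"
      using \<open>\<delta> > 0\<close> \<open>e > 0\<close> by (intro exI[of _ "min \<delta> e"]) auto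
  qed
qed

section \<open>From a given partition to the converse\<close>

text \<open>Restates the extended-real hypotheses of the converse over the reals, with a chosen
  member around each point in place of the partition.\<close>

lemma regular_cells_if_partition:
  assumes plp: "piecewise_linear_partition T (extend_infinity F (\<lambda>x. l x - x)) P"
    and bc: "boundary_conditions T (extend_infinity F (\<lambda>x. l x - x)) P"
  obtains K where "regular_cells T F l K"
proof -
  let ?g = "extend_infinity F (\<lambda>x. l x - x)"
  have part: "partition_on UNIV P" and int: "\<And>I. I \<in> P \<Longrightarrow> is_interval I"
    and pieces: "\<And>I. I \<in> P \<Longrightarrow>
      (\<exists>d. \<forall>x\<in>I. x \<in> F \<and> l x = d \<and> x \<le> d \<and> d \<le> x + T) \<or> I \<inter> F = {}"
    using plp unfolding piecewise_linear_partition_extend_infinity by auto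
  have "\<forall>x. \<exists>I. I \<in> P \<and> x \<in> I" using partition_onD1[OF part] by auto
  then obtain K where K: "\<And>x. K x \<in> P" "\<And>x. x \<in> K x" by metis
  have ne: "K x \<noteq> {}" for x using K(2)[of x] by auto
  have left: "?g a \<noteq> ereal T \<Longrightarrow> (?g \<longlongrightarrow> ereal 0) (at_left a)" "a \<notin> K x \<Longrightarrow> ?g a = 0"
    if "least_bound (K x) a" for x a
  proof -
    have "left_end (K x) = ereal a" using left_end_eq_ereal_iff[OF ne] that by blast
    then show "?g a \<noteq> ereal T \<Longrightarrow> (?g \<longlongrightarrow> ereal 0) (at_left a)" "a \<notin> K x \<Longrightarrow> ?g a = 0"
      using bc K(1) unfolding boundary_conditions_def zero_ereal_def by blast+
  qed
  have right: "?g b \<noteq> 0 \<Longrightarrow> (?g \<longlongrightarrow> ereal T) (at_right b)" "b \<notin> K x \<Longrightarrow> ?g b = ereal T"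
    if "greatest_bound (K x) b" for x b
  proof -
    have "right_end (K x) = ereal b" using right_end_eq_ereal_iff[OF ne] that by blast
    then show "?g b \<noteq> 0 \<Longrightarrow> (?g \<longlongrightarrow> ereal T) (at_right b)" "b \<notin> K x \<Longrightarrow> ?g b = ereal T"
      using bc K(1) unfolding boundary_conditions_def by blast+
  qed
  have "regular_cells T F l K"
    unfolding regular_cells_def
  proof (intro conjI allI ballI impI)
    fix x assume "x \<in> F"
    then show "x \<le> l x" "l x \<le> x + T" using pieces[OF K(1), of x] K(2)[of x] by auto
  next
    fix x show "x \<in> K x" "is_interval (K x)" using K int by auto
  next
    fix x y assume y: "y \<in> K x"
    show "y \<in> F \<longleftrightarrow> x \<in> F" using pieces[OF K(1), of x] K(2)[of x] y by blast
    show "l y = l x" if "x \<in> F" using pieces[OF K(1), of x] K(2)[of x] y that by force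
  next
    fix x a e :: real
    assume lb: "least_bound (K x) a" and "\<not> (a \<in> F \<and> l a = a + T)" and "0 < e"
    then have "?g a \<noteq> ereal T" by (auto simp: extend_infinity_def)
    then have "(?g \<longlongrightarrow> ereal 0) (at_left a)"
      by (rule left(1)[OF lb])
    then obtain \<delta> where "\<delta> > 0" "\<And>y. a - \<delta> < y \<Longrightarrow> y < a \<Longrightarrow> y \<in> F \<and> \<bar>l y - y - 0\<bar> < e"
      unfolding tendsto_at_left_extend_infinity_iff using \<open>0 < e\<close> by blast
    then show "\<exists>\<delta>>0. \<forall>y. a - \<delta> < y \<and> y < a \<longrightarrow> y \<in> F \<and> l y < y + e"
      by (intro exI[of _ \<delta>]) force
  next
    fix x a assume lb: "least_bound (K x) a" and "a \<notin> K x"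
    then have "?g a = 0" by (rule left(2))
    then show "a \<in> F" "l a = a" by (auto simp: extend_infinity_def split: if_splits)
  next
    fix x b e :: real
    assume gb: "greatest_bound (K x) b" and "\<not> (b \<in> F \<and> l b = b)" and "0 < e"
    then have "?g b \<noteq> 0" by (auto simp: extend_infinity_def)
    then have "(?g \<longlongrightarrow> ereal T) (at_right b)"
      by (rule right(1)[OF gb])
    then obtain \<delta> where "\<delta> > 0" "\<And>y. b < y \<Longrightarrow> y < b + \<delta> \<Longrightarrow> y \<in> F \<and> \<bar>l y - y - T\<bar> < e"
      unfolding tendsto_at_right_extend_infinity_iff using \<open>0 < e\<close> by blast
    then show "\<exists>\<delta>>0. \<forall>y. b < y \<and> y < b + \<delta> \<longrightarrow> y \<in> F \<and> y + T - e < l y"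
      by (intro exI[of _ \<delta>]) force
  next
    fix x b assume gb: "greatest_bound (K x) b" and "b \<notin> K x"
    then have "?g b = ereal T" by (rule right(2))
    then show "b \<in> F" "l b = b + T" by (auto simp: algebra_simps extend_infinity_def split: if_splits)
  qed
  then show thesis by (rule that)
qed

text \<open>Members carry only real values or plus infinity, which makes the representation by
  \<open>extend_infinity\<close> available in the converse.\<close>

lemma piecewise_linear_partition_not_minus_infinity:
  assumes "piecewise_linear_partition T g P"
  shows "g x \<noteq> - \<infinity>"
proof -
  have "partition_on UNIV P" using assms by (simp add: piecewise_linear_partition_def)
  then obtain I where "I \<in> P" "x \<in> I" using partition_onD1 by blast
  then have "linear_piece T g I \<or> infinite_piece g I"
    using assms by (auto simp: piecewise_linear_partition_def)
  with \<open>x \<in> I\<close> show ?thesis by (auto simp: linear_piece_def infinite_piece_def)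
qed

theorem theorem5p1:
  fixes H :: "(real \<Rightarrow> real) set" and T :: real
  assumes "closed_under_shifts H" and "T > 0"
  shows "(\<forall>L f. local_intrinsic_location H T L \<and> f \<in> H \<longrightarrow>
            (\<exists>P. roughest (piecewise_linear_partition T (displacement L f)) P \<and>
                 boundary_conditions T (displacement L f) P)) \<and>
         (\<forall>L. sections_measurable H L \<and> shift_compatible H L \<and>
            (\<forall>f\<in>H. \<exists>P. piecewise_linear_partition T (displacement L f) P \<and>
                        boundary_conditions T (displacement L f) P) \<longrightarrow>
            local_intrinsic_location H T L)"
proof (intro conjI allI impI; (elim conjE)?)
  fix L f assume L: "local_intrinsic_location H T L" and f: "f \<in> H"
  have range: "L f x \<in> {ereal x..ereal (x + T)} \<union> {\<infinity>}" for x
    using L f by (simp add: local_intrinsic_location_def)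
  have "L f x \<noteq> - \<infinity>" for x using range[of x] by auto
  then obtain F l where Fl: "L f = extend_infinity F l" using ex_extend_infinity by blast
  have "local_on T F l"
    unfolding local_on_iff[OF Fl] using L f unfolding local_intrinsic_location_def by blast
  then show "\<exists>P. roughest (piecewise_linear_partition T (displacement L f)) P \<and>
                 boundary_conditions T (displacement L f) P"
    unfolding displacement_extend_infinity[of L f, OF Fl]
    using roughest_cells[OF \<open>local_on T F l\<close>] boundary_conditions_cells[OF \<open>T > 0\<close> \<open>local_on T F l\<close>]
    by (intro exI conjI)
next
  fix L
  assume L: "sections_measurable H L" "shift_compatible H L"
    and P: "\<forall>f\<in>H. \<exists>P. piecewise_linear_partition T (displacement L f) P \<and>
                        boundary_conditions T (displacement L f) P"
  \<comment> \<open>Measurability and shift compatibility are given; the window and local conditions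
    remain, and they concern each \<open>f\<close> separately.\<close>
  have *: "(\<forall>a. L f a \<in> {ereal a..ereal (a + T)} \<union> {\<infinity>}) \<and>
    (\<forall>a b. L f a \<in> {ereal b..ereal (b + T)} \<longrightarrow>
        L f b = L f a \<or> L f b \<in> {ereal b..ereal (b + T)} - {ereal a..ereal (a + T)})"
    if f: "f \<in> H" for f
  proof -
    obtain P where P: "piecewise_linear_partition T (displacement L f) P"
      "boundary_conditions T (displacement L f) P"
      using bspec[OF P f] by (elim exE conjE)
    have "L f x \<noteq> - \<infinity>" for x
      using piecewise_linear_partition_not_minus_infinity[OF P(1), of x]
      by (auto simp: displacement_def)
    then obtain F l where Fl: "L f = extend_infinity F l" using ex_extend_infinity by blast
    obtain K where "regular_cells T F l K"
      using regular_cells_if_partition P unfolding displacement_extend_infinity[of L f, OF Fl] .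
    then have "local_on T F l" by (rule local_on_if_regular_cells[OF \<open>T > 0\<close>])
    then show ?thesis unfolding local_on_iff[OF Fl] .
  qed
  show "local_intrinsic_location H T L"
    unfolding local_intrinsic_location_def
    by (intro conjI ballI L conjunct1[OF *] conjunct2[OF *])
qed

end
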